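(* Let $G$ be a connected directed tree (arbitrary edge orientation) with $N$ vertices and $m$ edges, let $0<\beta<1$, and let $H$ be the stabilizing positive semidefinite solution of the reduced DARE. Define $$Y=\begin{bmatrix} Z & -R \\ 0 & I_m \end{bmatrix},\qquad U=\begin{bmatrix} FZ & 0 \end{bmatrix},\qquad Z=[\,C\ \ \mathbf 1\,]\in\mathbb{R}^{N\times N},\qquad F=-rD^{-1}(-S^\top+\beta C^\top H),$$ where the zero block of $U$ is $m\times m$. Then $(Y,U)$ is an RI (right-inverse) implementation of the optimal feedback $u=-Kx$; that is, $Y$ is nonsingular and $K=-UY^{-1}$.
   Context: A connected directed tree is a finite directed graph whose underlying undirected graph is a tree (so $m=N-1$). Edge $e_i$ is directed from its sender $s_i$ to its receiver $t_i$. Let $\hat e_v\in\mathbb{R}^N$ be the standard basis vector at vertex $v$ and $\mathbf 1$ the all-ones vector. The matrices $S,R\in\mathbb{R}^{N\times m}$ have $i$th columns $\hat e_{s_i}$ and $\hat e_{t_i}$ respectively, and $C=R-S$. Put $r=\sqrt\beta$. Reduced DARE: for symmetric $H\in\mathbb{R}^{N\times N}$ put $D=S^\top S+\beta C^\top HC$ and $N_H=-S+\beta HC$. The reduced DARE is $H=I+\beta H-N_HD^{-1}N_H^\top$, with $D$ required to be nonsingular. A solution $H$ is called stabilizing if every eigenvalue of $r(I-CD^{-1}N_H^\top)$ lies in the open unit disk. (The reduced DARE has exactly one stabilizing positive semidefinite solution.) Optimal feedback: the dynamics are $x_{k+1}=Ax_k+Bu_k$ with state $x=(s,d)\in\mathbb{R}^{N+m}$,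 input $u\in\mathbb{R}^m$, and $$A=r\begin{bmatrix} I & R \\ 0 & 0 \end{bmatrix},\qquad B=\begin{bmatrix} -S \\ I_m \end{bmatrix}.$$ The optimal gain is $K=(B^\top PB)^{-1}B^\top PA$, where $$P=\begin{bmatrix} I+\beta H & \beta HR \\ \beta R^\top H & \beta R^\top HR \end{bmatrix}$$ is the stabilizing solution of the discrete-time algebraic Riccati equation $P=Q+A^\top PA-A^\top PB(B^\top PB)^{-1}B^\top PA$ with $Q=\begin{bmatrix} I_N & 0 \\ 0 & 0 \end{bmatrix}$; equivalently $K=rD^{-1}N_H^\top[\,I\ \ R\,]$. An RI implementation of a feedback $u=-Kx$ is a pair of matrices $(Y,U)$ with $Y$ nonsingular and $K=-UY^{-1}$. *)

theory Defs
  imports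
    "Graph_Theory.Digraph_Component"
    "Jordan_Normal_Form.Char_Poly"
    "Jordan_Normal_Form.Gauss_Jordan_Elimination"
    Complex_Main
begin

text \<open>
  A cycle of the underlying undirected multigraph: \<open>k \<ge> 1\<close> distinct vertices and
  \<open>k\<close> distinct arcs, each arc joining cyclically consecutive vertices in either direction.
  The case \<open>k = 1\<close> is a loop, and \<open>k = 2\<close> is a pair of parallel or antiparallel arcs.
\<close>

definition undirected_cycle :: "('v, 'e) pre_digraph \<Rightarrow> 'v list \<Rightarrow> 'e list \<Rightarrow> bool" where
  "undirected_cycle G us as \<longleftrightarrow>
     as \<noteq> [] \<and> length us = length as \<and> distinct us \<and> distinct as \<and>
     set us \<subseteq> verts G \<and> set as \<subseteq> arcs G \<and>
     (\<forall>i < length as.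
        {tail G (as ! i), head G (as ! i)} = {us ! i, us ! (Suc i mod length us)})"

text \<open>
  The library constant \<^const>\<open>Digraph_Component.tree\<close> only excludes directed cycles,
  so it also holds for, e.g., a transitively oriented triangle. By contrast
  \<^const>\<open>Digraph_Component.connected\<close> already refers to the underlying undirected graph
  (and includes nonemptiness of the vertex set).
\<close>

definition directed_tree :: "('v, 'e) pre_digraph \<Rightarrow> bool" where
  "directed_tree G \<longleftrightarrow>
     fin_digraph G \<and> Digraph_Component.connected G \<and>
     (\<nexists>us as. undirected_cycle G us as)"

text \<open>
  Vertices and arcs are numbered by lists \<open>vs\<close>, \<open>es\<close>, so that the column with index
  \<open>i\<close> belongs to the arc \<open>es ! i\<close>.
\<close>

definition sender_mat :: "('v, 'e) pre_digraph \<Rightarrow> 'v list \<Rightarrow> 'e list \<Rightarrow> real mat" where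
  "sender_mat G vs es =
     mat (length vs) (length es) (\<lambda>(v, i). if vs ! v = tail G (es ! i) then 1 else 0)"

definition receiver_mat :: "('v, 'e) pre_digraph \<Rightarrow> 'v list \<Rightarrow> 'e list \<Rightarrow> real mat" where
  "receiver_mat G vs es =
     mat (length vs) (length es) (\<lambda>(v, i). if vs ! v = head G (es ! i) then 1 else 0)"

text \<open>Only meaningful for nonsingular square matrices; otherwise unspecified.\<close>

definition minv :: "'a::field mat \<Rightarrow> 'a mat" where
  "minv A = the (mat_inverse A)"

definition append_columns :: "'a::zero mat \<Rightarrow> 'a mat \<Rightarrow> 'a mat"  (infixr \<open>@\<^sub>c\<close> 65) where
  "A @\<^sub>c B = four_block_mat A B (0\<^sub>m 0 (dim_col A)) (0\<^sub>m 0 (dim_col B))"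

definition ones_col :: "nat \<Rightarrow> real mat" where
  "ones_col n = mat n 1 (\<lambda>_. 1)"

definition psd_mat :: "nat \<Rightarrow> real mat \<Rightarrow> bool" where
  "psd_mat n A \<longleftrightarrow> A \<in> carrier_mat n n \<and> A\<^sup>T = A \<and>
     (\<forall>x \<in> carrier_vec n. x \<bullet> (A *\<^sub>v x) \<ge> 0)"

definition D_mat :: "real \<Rightarrow> real mat \<Rightarrow> real mat \<Rightarrow> real mat \<Rightarrow> real mat" where
  "D_mat \<beta> S R H = (let C = R - S in S\<^sup>T * S + \<beta> \<cdot>\<^sub>m (C\<^sup>T * H * C))"

definition N_mat :: "real \<Rightarrow> real mat \<Rightarrow> real mat \<Rightarrow> real mat \<Rightarrow> real mat" where
  "N_mat \<beta> S R H = (let C = R - S in - S + \<beta> \<cdot>\<^sub>m (H * C))"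

definition reduced_DARE :: "real \<Rightarrow> real mat \<Rightarrow> real mat \<Rightarrow> real mat \<Rightarrow> bool" where
  "reduced_DARE \<beta> S R H \<longleftrightarrow>
     (let n = dim_row S; D = D_mat \<beta> S R H; NH = N_mat \<beta> S R H in
        H \<in> carrier_mat n n \<and> H\<^sup>T = H \<and> invertible_mat D \<and>
        H = 1\<^sub>m n + \<beta> \<cdot>\<^sub>m H - NH * minv D * NH\<^sup>T)"

definition stabilizing :: "real \<Rightarrow> real mat \<Rightarrow> real mat \<Rightarrow> real mat \<Rightarrow> bool" where
  "stabilizing \<beta> S R H \<longleftrightarrow>
     (let n = dim_row S; C = R - S; D = D_mat \<beta> S R H; NH = N_mat \<beta> S R H;
          M = sqrt \<beta> \<cdot>\<^sub>m (1\<^sub>m n - C * minv D * NH\<^sup>T)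
      in \<forall>z. eigenvalue (map_mat complex_of_real M) z \<longrightarrow> cmod z < 1)"

definition A_mat :: "real \<Rightarrow> real mat \<Rightarrow> real mat" where
  "A_mat \<beta> R = (let n = dim_row R; m = dim_col R in
     sqrt \<beta> \<cdot>\<^sub>m four_block_mat (1\<^sub>m n) R (0\<^sub>m m n) (0\<^sub>m m m))"

definition B_mat :: "real mat \<Rightarrow> real mat" where
  "B_mat S = (- S) @\<^sub>r 1\<^sub>m (dim_col S)"

text \<open>
  When \<open>H\<close> is the stabilizing positive semidefinite solution of the reduced equation,
  \<open>P_mat\<close> is the stabilizing solution of the full discrete-time algebraic Riccati equation
  for \<open>A_mat\<close>, \<open>B_mat\<close> with state cost \<open>diag(I, 0)\<close> and no input cost.
\<close>

definition P_mat :: "real \<Rightarrow> real mat \<Rightarrow> real mat \<Rightarrow> real mat" where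
  "P_mat \<beta> R H =
     four_block_mat (1\<^sub>m (dim_row R) + \<beta> \<cdot>\<^sub>m H) (\<beta> \<cdot>\<^sub>m (H * R))
                    (\<beta> \<cdot>\<^sub>m (R\<^sup>T * H)) (\<beta> \<cdot>\<^sub>m (R\<^sup>T * H * R))"

definition optimal_gain :: "real \<Rightarrow> real mat \<Rightarrow> real mat \<Rightarrow> real mat \<Rightarrow> real mat" where
  "optimal_gain \<beta> S R H = (let A = A_mat \<beta> R; B = B_mat S; P = P_mat \<beta> R H in
     minv (B\<^sup>T * P * B) * B\<^sup>T * P * A)"

definition RI_implementation :: "real mat \<Rightarrow> real mat \<Rightarrow> real mat \<Rightarrow> bool" where
  "RI_implementation K Y U \<longleftrightarrow>
     Y \<in> carrier_mat (dim_col K) (dim_col K) \<and>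
     U \<in> carrier_mat (dim_row K) (dim_col K) \<and>
     invertible_mat Y \<and> K = - (U * minv Y)"

end

theory Submission
  imports Defs
begin

text \<open>
  Substituting the block form of \<open>P\<close> into the optimal gain collapses it to
  \<open>K = - F [I R]\<close>: writing \<open>W = -S\<^sup>T + \<beta> C\<^sup>T H\<close>, one finds
  \<open>B\<^sup>T P = [W, \<beta> C\<^sup>T H R]\<close>, so that \<open>B\<^sup>T P B = D\<close> and \<open>B\<^sup>T P A = r W [I R]\<close>
  (\<open>optimal_gain_eq\<close>). With \<open>Y\<close> block triangular, \<open>[I R] Y = [Z, -R + R] = [Z, 0]\<close>, hence
  \<open>K Y = -[F Z, 0] = -U\<close>.

  The tree is what makes \<open>Y\<close> nonsingular, or equivalently the bordered incidence matrix
  \<open>Z = [C 1]\<close> square and nonsingular. Its columns are independent because the graph is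
  acyclic: the all-ones vector is orthogonal to the columns of \<open>C\<close>, and a nonzero vector in the
  kernel of \<open>C\<close> is a circulation, whose support has no leaf and therefore contains a cycle
  (\<open>leafless_imp_undirected_cycle\<close>, \<open>kernel_Z\<close>). Its rows are independent because the graph is
  connected: a vector annihilated by \<open>C\<^sup>T\<close> is a constant potential, and being orthogonal to the
  all-ones vector it vanishes (\<open>kernel_Z_transpose\<close>). Together these two facts also yield
  \<open>N = m + 1\<close> without a separate edge count (\<open>directed_tree_Z\<close>).
\<close>

section \<open>Cycles in graphs without leaves\<close>

definition undirected_path :: "('v, 'e) pre_digraph \<Rightarrow> 'v list \<Rightarrow> 'e list \<Rightarrow> bool" where
  "undirected_path G us as \<longleftrightarrow>
     length us = Suc (length as) \<and> distinct us \<and> distinct as \<and>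
     set us \<subseteq> verts G \<and> set as \<subseteq> arcs G \<and>
     (\<forall>i < length as. {tail G (as ! i), head G (as ! i)} = {us ! i, us ! Suc i})"

text \<open>
  Prepending an unused arc to a path either visits a new vertex or returns to the path; in the
  second case the initial segment up to the revisited vertex closes up to a cycle. Only the
  first arc of the path has to be avoided, since no other arc of it touches its first vertex.
\<close>

lemma undirected_path_extend:
  assumes "wf_digraph G" and path: "undirected_path G us as" and "as \<noteq> []"
    and b: "b \<in> arcs G" "b \<noteq> hd as" and ends: "{tail G b, head G b} = {w, hd us}"
  shows "undirected_path G (w # us) (b # as) \<or> (\<exists>us' as'. undirected_cycle G us' as')"
proof -
  have len: "length us = Suc (length as)" and du: "distinct us" and da: "distinct as"
    and usv: "set us \<subseteq> verts G" and asa: "set as \<subseteq> arcs G"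
    and adj: "\<And>i. i < length as \<Longrightarrow> {tail G (as ! i), head G (as ! i)} = {us ! i, us ! Suc i}"
    using path by (auto simp: undirected_path_def)
  have us0: "hd us = us ! 0" using len by (cases us) auto
  have wv: "w \<in> verts G"
  proof -
    interpret wf_digraph G by fact
    have "w \<in> {tail G b, head G b}" using ends by simp
    then show ?thesis using b(1) by auto
  qed
  have b_new: "b \<notin> set as"
  proof
    assume "b \<in> set as"
    then obtain i where i: "i < length as" "b = as ! i" by (metis in_set_conv_nth)
    have "i \<noteq> 0" using b(2) i \<open>as \<noteq> []\<close> by (metis hd_conv_nth)
    moreover have "us ! 0 \<in> {us ! i, us ! Suc i}" using adj[OF i(1)] i(2) ends us0 by auto
    ultimately show False using du len i(1) by (auto simp: nth_eq_iff_index_eq)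
  qed
  show ?thesis
  proof (cases "w \<in> set us")
    case False
    have "{tail G ((b # as) ! i), head G ((b # as) ! i)} = {(w # us) ! i, (w # us) ! Suc i}"
      if "i < length (b # as)" for i
      using that ends us0 adj by (cases i) auto
    then have "undirected_path G (w # us) (b # as)"
      using False len du da usv asa b(1) b_new wv by (auto simp: undirected_path_def)
    then show ?thesis ..
  next
    case True
    then obtain j where j: "j < length us" "w = us ! j" by (metis in_set_conv_nth)
    \<comment> \<open>The new arc joins \<open>us ! j\<close> to \<open>us ! 0\<close>; placed last, it closes the segment cyclically.\<close>
    let ?us = "take (Suc j) us" and ?as = "take j as @ [b]"
    have lu: "length ?us = Suc j" and la: "length (take j as) = j" using j len by auto
    have "{tail G (?as ! i), head G (?as ! i)} = {?us ! i, ?us ! (Suc i mod length ?us)}"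
      if "i < length ?as" for i
    proof (cases "i < j")
      case True
      then show ?thesis using adj[of i] lu la j len by (simp add: nth_append)
    next
      case False
      then have "i = j" using that la by simp
      then show ?thesis using ends us0 j lu la by (simp add: nth_append)
    qed
    moreover have "set ?us \<subseteq> verts G" "set ?as \<subseteq> arcs G"
      using usv asa b(1) set_take_subset[of "Suc j" us] set_take_subset[of j as] by auto
    moreover have "distinct ?as" using da b_new set_take_subset[of j as] by auto
    ultimately have "undirected_cycle G ?us ?as"
      using du lu la unfolding undirected_cycle_def by auto
    then show ?thesis by blast
  qed
qed

text \<open>
  A walk that never turns back can always be continued if every end of an arc in \<open>X\<close> meets
  another arc in \<open>X\<close>. Without cycles the walk never repeats a vertex, so it would outgrow the
  finite vertex set. Loops are exempted in the hypothesis because a loop is a cycle by itself.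
\<close>

lemma leafless_imp_undirected_cycle:
  assumes "fin_digraph G" and X: "X \<subseteq> arcs G" "X \<noteq> {}"
    and no_leaf: "\<And>a v. \<lbrakk>a \<in> X; v \<in> {tail G a, head G a}; tail G a \<noteq> head G a\<rbrakk>
       \<Longrightarrow> \<exists>b\<in>X. b \<noteq> a \<and> v \<in> {tail G b, head G b}"
  shows "\<exists>us as. undirected_cycle G us as"
proof (rule ccontr)
  interpret fin_digraph G by fact
  assume acyclic: "\<not> ?thesis"
  have no_loop: "tail G a \<noteq> head G a" if "a \<in> X" for a
  proof
    assume "tail G a = head G a"
    then have "undirected_cycle G [tail G a] [a]"
      using that X by (auto simp: undirected_cycle_def)
    then show False using acyclic by blast
  qed
  have "\<exists>us as. undirected_path G us as \<and> length as = Suc k \<and> hd as \<in> X" for k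
  proof (induction k)
    case 0
    obtain a where a: "a \<in> X" using X(2) by blast
    then have "undirected_path G [tail G a, head G a] [a]"
      using X(1) no_loop by (auto simp: undirected_path_def)
    then show ?case using a by force
  next
    case (Suc k)
    then obtain us as where path: "undirected_path G us as"
      and len: "length as = Suc k" and hd: "hd as \<in> X" by blast
    have ne: "as \<noteq> []" "us \<noteq> []" using len path by (auto simp: undirected_path_def)
    have "{tail G (as ! 0), head G (as ! 0)} = {us ! 0, us ! Suc 0}"
      using path len by (simp add: undirected_path_def)
    then have "hd us \<in> {tail G (hd as), head G (hd as)}" using ne by (auto simp: hd_conv_nth)
    then obtain b where b: "b \<in> X" "b \<noteq> hd as" "hd us \<in> {tail G b, head G b}"
      using no_leaf[OF hd _ no_loop[OF hd]] by blast
    define w where "w = (if hd us = tail G b then head G b else tail G b)"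
    have w: "{tail G b, head G b} = {w, hd us}" using b(3) by (auto simp: w_def)
    have "undirected_path G (w # us) (b # as)"
      using undirected_path_extend[OF wf_digraph_axioms path ne(1) subsetD[OF X(1) b(1)] b(2) w]
        acyclic by simp
    then show ?case using b(1) len by force
  qed
  then obtain us as where "undirected_path G us as" "length as = Suc (card (verts G))" by blast
  then have "card (verts G) < card (set us)" "set us \<subseteq> verts G"
    by (auto simp: undirected_path_def distinct_card)
  then show False using card_mono[OF finite_verts] by (metis not_le)
qed

section \<open>Kernels of the incidence matrix and of its transpose\<close>

text \<open>
  Equality of the values at the two ends of an arc propagates along undirected walks.
\<close>

lemma connected_imp_constant:
  assumes conn: "Digraph_Component.connected G"
    and eq: "\<And>a. a \<in> arcs G \<Longrightarrow> f (tail G a) = f (head G a)"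
    and u: "u \<in> verts G" and v: "v \<in> verts G"
  shows "f u = f v"
proof -
  have "u \<rightarrow>\<^sup>*\<^bsub>with_proj (mk_symmetric G)\<^esub> v"
    using conn u v by (auto simp: connected_def strongly_connected_def)
  then have "(u, v) \<in> rtrancl_on (verts G) (parcs (mk_symmetric G))"
    by (simp add: reachable_def)
  then show ?thesis
    by (induction rule: rtrancl_on_induct) (auto simp: parcs_mk_symmetric eq)
qed

locale incidence =
  fixes G :: "('v, 'e) pre_digraph" and vs :: "'v list" and es :: "'e list"
  assumes fin: "fin_digraph G"
    and vs: "distinct vs" "set vs = verts G"
    and es: "distinct es" "set es = arcs G"
begin

definition C :: "real mat" where
  "C = receiver_mat G vs es - sender_mat G vs es"

lemma C_carrier [simp]: "C \<in> carrier_mat (length vs) (length es)"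
  by (intro carrier_matI) (simp_all add: C_def receiver_mat_def sender_mat_def)

lemma dim_C [simp]: "dim_row C = length vs" "dim_col C = length es"
  using carrier_matD[OF C_carrier] .

lemma C_index:
  "v < length vs \<Longrightarrow> i < length es \<Longrightarrow>
     C $$ (v, i) = (if vs ! v = head G (es ! i) then 1 else 0)
                 - (if vs ! v = tail G (es ! i) then 1 else 0)"
  by (simp add: C_def receiver_mat_def sender_mat_def)

lemma C_mult_index:
  "y \<in> carrier_vec (length es) \<Longrightarrow> v < length vs \<Longrightarrow>
     (C *\<^sub>v y) $ v = (\<Sum>i<length es. C $$ (v, i) * y $ i)"
  by (simp add: scalar_prod_def atLeast0LessThan)

lemma vertex_index:
  assumes "u \<in> verts G"
  obtains v where "v < length vs" "vs ! v = u"
  using assms unfolding vs(2)[symmetric] in_set_conv_nth by blast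

lemma arc_ends:
  assumes "i < length es"
  shows "tail G (es ! i) \<in> verts G" "head G (es ! i) \<in> verts G"
proof -
  interpret fin_digraph G by (rule fin)
  have "es ! i \<in> arcs G" using assms es(2) nth_mem by metis
  then show "tail G (es ! i) \<in> verts G" "head G (es ! i) \<in> verts G" by auto
qed

text \<open>
  A vector in the kernel is a circulation: inflow equals outflow at each vertex. If a vertex met
  only one arc (not a loop) carrying flow, the balance there would be plus or minus that flow,
  which is nonzero. Hence the support is leafless, and an acyclic graph leaves no room for it.
\<close>

lemma kernel_C:
  assumes acyclic: "\<nexists>us as. undirected_cycle G us as"
    and y: "y \<in> carrier_vec (length es)" and Cy: "C *\<^sub>v y = 0\<^sub>v (length vs)"
  shows "y = 0\<^sub>v (length es)"
proof (rule ccontr)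
  assume "y \<noteq> 0\<^sub>v (length es)"
  then obtain i0 where i0: "i0 < length es" "y $ i0 \<noteq> 0"
    using y by (auto simp: vec_eq_iff)
  define X where "X = {es ! i | i. i < length es \<and> y $ i \<noteq> 0}"
  have "\<exists>us as. undirected_cycle G us as"
  proof (rule leafless_imp_undirected_cycle[OF fin, of X])
    show "X \<subseteq> arcs G" unfolding X_def es(2)[symmetric] by auto
    show "X \<noteq> {}" using i0 by (auto simp: X_def)
  next
    fix a u
    assume "a \<in> X" and u: "u \<in> {tail G a, head G a}" and no_loop: "tail G a \<noteq> head G a"
    then obtain i where i: "i < length es" "y $ i \<noteq> 0" "a = es ! i" by (auto simp: X_def)
    obtain v where v: "v < length vs" "vs ! v = u"
      using vertex_index u arc_ends[OF i(1)] i(3) by auto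
    show "\<exists>b\<in>X. b \<noteq> a \<and> u \<in> {tail G b, head G b}"
    proof (rule ccontr)
      assume lonely: "\<not> ?thesis"
      have zero: "C $$ (v, j) * y $ j = 0" if j: "j < length es" "j \<noteq> i" for j
      proof (cases "y $ j = 0")
        case False
        have "es ! j \<noteq> a" using j i es(1) by (simp add: nth_eq_iff_index_eq)
        moreover have "es ! j \<in> X" using j False by (auto simp: X_def)
        ultimately show ?thesis using lonely v j by (auto simp: C_index)
      qed simp
      then have "(C *\<^sub>v y) $ v = C $$ (v, i) * y $ i"
        unfolding C_mult_index[OF y v(1)] using i(1)
        by (subst sum.remove[of _ i]) (auto intro!: sum.neutral simp del: mult_eq_0_iff simp: zero)
      moreover have "C $$ (v, i) \<noteq> 0" using u v i no_loop by (auto simp: C_index)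
      ultimately show False using Cy v i by simp
    qed
  qed
  then show False using acyclic by blast
qed

text \<open>
  The entry of \<open>C\<^sup>T w\<close> at an arc is the value of the potential \<open>w\<close> at its head minus that at its
  tail, so \<open>connected_imp_constant\<close> applies.
\<close>

lemma kernel_C_transpose:
  assumes conn: "Digraph_Component.connected G"
    and w: "w \<in> carrier_vec (length vs)" and Cw: "C\<^sup>T *\<^sub>v w = 0\<^sub>v (length es)"
    and uv: "u < length vs" "v < length vs"
  shows "w $ u = w $ v"
proof -
  \<comment> \<open>The potential transported from vertex numbers to vertices.\<close>
  define f where "f x = (\<Sum>k<length vs. if vs ! k = x then w $ k else 0)" for x
  have f_nth: "f (vs ! k) = w $ k" if "k < length vs" for k
  proof -
    have "f (vs ! k) = (\<Sum>l<length vs. if l = k then w $ l else 0)"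
      unfolding f_def using that vs(1) by (intro sum.cong) (auto simp: nth_eq_iff_index_eq)
    then show ?thesis using that by simp
  qed
  have "f (tail G a) = f (head G a)" if a: "a \<in> arcs G" for a
  proof -
    obtain i where i: "i < length es" "a = es ! i" using a es(2) by (metis in_set_conv_nth)
    have "0 = (C\<^sup>T *\<^sub>v w) $ i" using Cw i by simp
    also have "\<dots> = (\<Sum>k<length vs. C $$ (k, i) * w $ k)"
      using w i by (simp add: scalar_prod_def atLeast0LessThan)
    also have "\<dots> = f (head G a) - f (tail G a)"
      unfolding f_def sum_subtractf[symmetric] using i by (intro sum.cong) (auto simp: C_index)
    finally show ?thesis by simp
  qed
  then have "f (vs ! u) = f (vs ! v)"
    using connected_imp_constant[OF conn, of f] uv vs(2) nth_mem by blast
  then show ?thesis using f_nth uv by simp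
qed

text \<open>Each column has one entry \<open>1\<close> and one entry \<open>-1\<close>, which cancel in place for a loop.\<close>

lemma column_sum_C: "i < length es \<Longrightarrow> (\<Sum>v<length vs. C $$ (v, i)) = 0"
proof -
  assume i: "i < length es"
  have one: "(\<Sum>v<length vs. if vs ! v = u then 1 else 0) = (1::real)" if u: "u \<in> verts G" for u
  proof -
    obtain k where k: "k < length vs" "vs ! k = u" using vertex_index[OF u] .
    then have "(\<Sum>v<length vs. if vs ! v = u then 1 else 0)
        = (\<Sum>v<length vs. if v = k then 1 else (0::real))"
      using vs(1) by (intro sum.cong) (auto simp: nth_eq_iff_index_eq)
    then show ?thesis using k by simp
  qed
  have "(\<Sum>v<length vs. C $$ (v, i))
      = (\<Sum>v<length vs. (if vs ! v = head G (es ! i) then 1 else 0)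
                 - (if vs ! v = tail G (es ! i) then 1 else 0))"
    using i by (intro sum.cong) (auto simp: C_index)
  then show ?thesis using one arc_ends[OF i] by (simp add: sum_subtractf)
qed

end

section \<open>Injective and invertible matrices\<close>

text \<open>
  A matrix with more columns than rows becomes square and singular when padded with zero rows,
  and the padding does not change its kernel.
\<close>

lemma injective_mat_dim_le:
  fixes A :: "'a::field mat"
  assumes A: "A \<in> carrier_mat nr nc"
    and inj: "\<And>x. x \<in> carrier_vec nc \<Longrightarrow> A *\<^sub>v x = 0\<^sub>v nr \<Longrightarrow> x = 0\<^sub>v nc"
  shows "nc \<le> nr"
proof (rule ccontr)
  assume "\<not> nc \<le> nr"
  then have nr: "nr < nc" by simp
  define E where "E = A @\<^sub>r 0\<^sub>m (nc - nr) nc"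
  have Ec: "E \<in> carrier_mat nc nc"
    using carrier_append_rows[OF A, of "0\<^sub>m (nc - nr) nc" "nc - nr"] nr by (simp add: E_def)
  have "row E (nc - 1) = 0\<^sub>v nc"
    using nr A by (intro eq_vecI) (auto simp: E_def append_rows_def)
  then have "det E = 0"
  proof -
    have "E = mat\<^sub>r nc nc (\<lambda>i. if i = nc - 1 then 0\<^sub>v nc else row E i)"
      using Ec \<open>row E (nc - 1) = 0\<^sub>v nc\<close> nr
      by (intro eq_rowI) (auto simp: row_mat_of_row_fun)
    moreover have "det \<dots> = 0" using nr Ec by (intro det_row_0) auto
    ultimately show ?thesis by simp
  qed
  then obtain x where x: "x \<in> carrier_vec nc" "x \<noteq> 0\<^sub>v nc" "E *\<^sub>v x = 0\<^sub>v nc"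
    using det_0_iff_vec_prod_zero[OF Ec] by blast
  have "(A *\<^sub>v x) @\<^sub>v (0\<^sub>m (nc - nr) nc *\<^sub>v x) = 0\<^sub>v nc"
    using x(3) unfolding E_def by (subst (asm) mat_mult_append[OF A _ x(1)]) auto
  also have "\<dots> = 0\<^sub>v nr @\<^sub>v 0\<^sub>v (nc - nr)" using nr by (intro eq_vecI) auto
  finally have "A *\<^sub>v x = 0\<^sub>v nr" using A x(1) by (subst (asm) append_vec_eq[of _ nr]) auto
  then show False using inj x by blast
qed

lemma minv_inverse:
  fixes A :: "'a::field mat"
  assumes A: "A \<in> carrier_mat n n" and inv: "invertible_mat A"
  shows "A * minv A = 1\<^sub>m n" "minv A * A = 1\<^sub>m n" "minv A \<in> carrier_mat n n"
proof -
  obtain B where B: "A * B = 1\<^sub>m n" "B * A = 1\<^sub>m (dim_row B)"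
    using inv A by (auto simp: invertible_mat_def inverts_mat_def)
  have Bc: "B \<in> carrier_mat n n"
  proof
    show "dim_row B = n"
      using arg_cong[OF B(2), of dim_col] A by simp
    show "dim_col B = n" using arg_cong[OF B(1), of dim_col] by simp
  qed
  then have "A \<in> Units (ring_mat TYPE('a) n ())"
    using A B by (auto simp: Units_def ring_mat_def)
  then obtain B' where "mat_inverse A = Some B'"
    using mat_inverse(1)[OF A, of "()"] by (cases "mat_inverse A") auto
  from mat_inverse(2)[OF A this] this
  show "A * minv A = 1\<^sub>m n" "minv A * A = 1\<^sub>m n" "minv A \<in> carrier_mat n n"
    by (auto simp: minv_def)
qed

lemma det_nonzero_imp_invertible_mat:
  fixes A :: "'a::field mat"
  assumes A: "A \<in> carrier_mat n n" and det: "det A \<noteq> 0"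
  shows "invertible_mat A"
proof -
  have "A \<in> Units (ring_mat TYPE('a) n ())" by (rule det_non_zero_imp_unit[OF A det])
  then obtain B where "B \<in> carrier_mat n n" "A * B = 1\<^sub>m n" "B * A = 1\<^sub>m n"
    by (auto simp: Units_def ring_mat_def)
  then show ?thesis using A by (auto simp: invertible_mat_def inverts_mat_def)
qed

section \<open>Products of block columns\<close>

lemma append_columns_carrier [simp]:
  "A \<in> carrier_mat n k \<Longrightarrow> B \<in> carrier_mat n l \<Longrightarrow> A @\<^sub>c B \<in> carrier_mat n (k + l)"
  by (intro carrier_matI) (auto simp: append_columns_def)

lemma append_columns_index:
  assumes "A \<in> carrier_mat n k" "B \<in> carrier_mat n l" "i < n" "j < k + l"
  shows "(A @\<^sub>c B) $$ (i, j) = (if j < k then A $$ (i, j) else B $$ (i, j - k))"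
  using assms by (auto simp: append_columns_def)

lemma col_append_columns:
  assumes "A \<in> carrier_mat n k" "B \<in> carrier_mat n l" "j < k + l"
  shows "col (A @\<^sub>c B) j = (if j < k then col A j else col B (j - k))"
  using assms append_columns_carrier[OF assms(1,2)]
  by (intro eq_vecI) (auto simp: append_columns_index simp del: append_columns_carrier)

lemma mult_append_columns:
  fixes A :: "'a::comm_semiring_1 mat"
  assumes A: "A \<in> carrier_mat n k" and B: "B \<in> carrier_mat k l" and B': "B' \<in> carrier_mat k l'"
  shows "A * (B @\<^sub>c B') = (A * B) @\<^sub>c (A * B')"
proof -
  note c = append_columns_carrier[OF B B']
    append_columns_carrier[OF mult_carrier_mat[OF A B] mult_carrier_mat[OF A B']]
  have "(A * (B @\<^sub>c B')) $$ (i, j) = ((A * B) @\<^sub>c (A * B')) $$ (i, j)"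
    if ij: "i < n" "j < l + l'" for i j
    unfolding append_columns_index[OF mult_carrier_mat[OF A B] mult_carrier_mat[OF A B'] ij]
    using ij A B B' carrier_matD[OF c(1)] col_append_columns[OF B B' ij(2)] by auto
  then show ?thesis using A c by (intro eq_matI) auto
qed

lemma smult_append_columns:
  fixes A :: "'a::semiring_0 mat"
  assumes "A \<in> carrier_mat n k" "B \<in> carrier_mat n l"
  shows "c \<cdot>\<^sub>m (A @\<^sub>c B) = (c \<cdot>\<^sub>m A) @\<^sub>c (c \<cdot>\<^sub>m B)"
  using assms unfolding append_columns_def
  by (subst smult_four_block_mat[of _ n k _ l _ 0]) auto

lemma append_columns_mult_four_block:
  fixes A :: "'a::comm_semiring_1 mat"
  assumes "A \<in> carrier_mat n k" "A' \<in> carrier_mat n k'"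
    and "B1 \<in> carrier_mat k l" "B2 \<in> carrier_mat k l'" "B3 \<in> carrier_mat k' l" "B4 \<in> carrier_mat k' l'"
  shows "(A @\<^sub>c A') * four_block_mat B1 B2 B3 B4
    = (A * B1 + A' * B3) @\<^sub>c (A * B2 + A' * B4)"
  using assms unfolding append_columns_def
  by (subst mult_four_block_mat[of _ n k _ k' _ 0 _ _ l _ l']) auto

lemma append_columns_mult_rows:
  fixes A :: "'a::comm_semiring_1 mat"
  assumes "A \<in> carrier_mat n k" "A' \<in> carrier_mat n k'"
    and "B \<in> carrier_mat k l" "B' \<in> carrier_mat k' l"
  shows "(A @\<^sub>c A') * (B @\<^sub>r B') = A * B + A' * B'"
proof -
  have "(A @\<^sub>c A') * (B @\<^sub>r B') = (A * B + A' * B') @\<^sub>c (A * 0\<^sub>m k 0 + A' * 0\<^sub>m k' 0)"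
    unfolding append_rows_def using assms
    by (subst append_columns_mult_four_block[of _ n k _ k' _ l _ 0]) auto
  also have "\<dots> = A * B + A' * B'"
    using assms by (intro eq_matI) (auto simp: append_columns_def)
  finally show ?thesis .
qed

section \<open>The incidence matrix of a tree bordered by ones\<close>

context incidence
begin

definition Z :: "real mat" where
  "Z = C @\<^sub>c ones_col (length vs)"

lemma ones_col_carrier [simp]: "ones_col n \<in> carrier_mat n 1"
  by (simp add: ones_col_def)

lemma Z_carrier: "Z \<in> carrier_mat (length vs) (length es + 1)"
  unfolding Z_def by (rule append_columns_carrier[OF C_carrier ones_col_carrier])

lemma dim_Z [simp]: "dim_row Z = length vs" "dim_col Z = length es + 1"
  using carrier_matD[OF Z_carrier] .

lemma Z_index:
  "v < length vs \<Longrightarrow> i < length es + 1 \<Longrightarrow>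
     Z $$ (v, i) = (if i < length es then C $$ (v, i) else 1)"
  unfolding Z_def append_columns_index[OF C_carrier ones_col_carrier]
  by (simp add: ones_col_def)

text \<open>
  The last coordinate of \<open>x\<close> vanishes because summing all entries of \<open>Z x\<close> kills the part coming
  from \<open>C\<close>; the remaining coordinates then lie in the kernel of \<open>C\<close>.
\<close>

lemma kernel_Z:
  assumes acyclic: "\<nexists>us as. undirected_cycle G us as" and ne: "vs \<noteq> []"
    and x: "x \<in> carrier_vec (length es + 1)" and Zx: "Z *\<^sub>v x = 0\<^sub>v (length vs)"
  shows "x = 0\<^sub>v (length es + 1)"
proof -
  let ?m = "length es" and ?n = "length vs"
  have row: "(\<Sum>i<?m. C $$ (v, i) * x $ i) + x $ ?m = 0" if v: "v < ?n" for v
  proof -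
    have "0 = (Z *\<^sub>v x) $ v" using Zx v by simp
    also have "\<dots> = (\<Sum>i<?m + 1. Z $$ (v, i) * x $ i)"
      using x v by (simp add: scalar_prod_def atLeast0LessThan)
    also have "\<dots> = (\<Sum>i<?m. C $$ (v, i) * x $ i) + x $ ?m"
      using v by (simp add: Z_index)
    finally show ?thesis by simp
  qed
  have "0 = (\<Sum>v<?n. (\<Sum>i<?m. C $$ (v, i) * x $ i) + x $ ?m)" using row by simp
  also have "\<dots> = (\<Sum>i<?m. \<Sum>v<?n. C $$ (v, i) * x $ i) + ?n * x $ ?m"
    by (simp add: sum.distrib sum.swap[of _ "{..<?m}"])
  also have "(\<Sum>i<?m. \<Sum>v<?n. C $$ (v, i) * x $ i) = 0"
    by (simp add: sum_distrib_right[symmetric] column_sum_C)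
  finally have last: "x $ ?m = 0" using ne by simp
  define y where "y = vec ?m (\<lambda>i. x $ i)"
  have y: "y \<in> carrier_vec ?m" by (simp add: y_def)
  have "C *\<^sub>v y = 0\<^sub>v ?n"
  proof (rule eq_vecI)
    fix v assume "v < dim_vec (0\<^sub>v ?n :: real vec)"
    then have v: "v < ?n" by simp
    show "(C *\<^sub>v y) $ v = 0\<^sub>v ?n $ v"
      unfolding C_mult_index[OF y v] using row[OF v] last v by (simp add: y_def)
  qed simp
  then have y0: "y = 0\<^sub>v ?m" using kernel_C[OF acyclic y] by simp
  show ?thesis
  proof (rule eq_vecI)
    fix i assume "i < dim_vec (0\<^sub>v (?m + 1) :: real vec)"
    then consider "i < ?m" | "i = ?m" by fastforce
    then show "x $ i = 0\<^sub>v (?m + 1) $ i"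
    proof cases
      case 1
      then show ?thesis using arg_cong[OF y0, of "\<lambda>y. y $ i"] by (simp add: y_def)
    next
      case 2
      then show ?thesis using last by simp
    qed
  qed (use x in simp)
qed

text \<open>
  The first rows of \<open>Z\<^sup>T w = 0\<close> make \<open>w\<close> constant, and the last one makes its entries sum to zero.
\<close>

lemma kernel_Z_transpose:
  assumes conn: "Digraph_Component.connected G" and ne: "vs \<noteq> []"
    and w: "w \<in> carrier_vec (length vs)" and Zw: "Z\<^sup>T *\<^sub>v w = 0\<^sub>v (length es + 1)"
  shows "w = 0\<^sub>v (length vs)"
proof -
  let ?m = "length es" and ?n = "length vs"
  have col: "(\<Sum>v<?n. Z $$ (v, i) * w $ v) = 0" if i: "i < ?m + 1" for i
  proof -
    have "0 = (Z\<^sup>T *\<^sub>v w) $ i" using Zw i by simp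
    also have "\<dots> = (\<Sum>v<?n. Z $$ (v, i) * w $ v)"
      using w i by (simp add: scalar_prod_def atLeast0LessThan)
    finally show ?thesis by simp
  qed
  have "C\<^sup>T *\<^sub>v w = 0\<^sub>v ?m"
  proof (rule eq_vecI)
    fix i assume "i < dim_vec (0\<^sub>v ?m :: real vec)"
    then have i: "i < ?m" by simp
    have "(C\<^sup>T *\<^sub>v w) $ i = (\<Sum>v<?n. C $$ (v, i) * w $ v)"
      using w i by (simp add: scalar_prod_def atLeast0LessThan)
    also have "\<dots> = (\<Sum>v<?n. Z $$ (v, i) * w $ v)"
      using i by (intro sum.cong) (auto simp: Z_index)
    finally show "(C\<^sup>T *\<^sub>v w) $ i = 0\<^sub>v ?m $ i" using col[of i] i by simp
  qed simp
  then have const: "w $ v = w $ 0" if "v < ?n" for v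
    using kernel_C_transpose[OF conn w _ that, of 0] ne by simp
  have "(\<Sum>v<?n. Z $$ (v, ?m) * w $ v) = (\<Sum>v<?n. w $ 0)"
    using const by (intro sum.cong) (auto simp: Z_index)
  then have "w $ 0 = 0" using col[of ?m] ne by simp
  with const have "w $ v = 0" if "v < ?n" for v using that by simp
  then show ?thesis using w by (intro eq_vecI) simp_all
qed

text \<open>Injectivity of \<open>Z\<close> and of its transpose bounds each dimension by the other.\<close>

lemma directed_tree_Z:
  assumes "directed_tree G"
  shows "length vs = length es + 1" and "det Z \<noteq> 0"
proof -
  have conn: "Digraph_Component.connected G" and acyclic: "\<nexists>us as. undirected_cycle G us as"
    using assms by (auto simp: directed_tree_def)
  have ne: "vs \<noteq> []" using conn vs(2) by (auto simp: connected_def strongly_connected_def)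
  have "length es + 1 \<le> length vs"
    using injective_mat_dim_le[OF Z_carrier] kernel_Z[OF acyclic ne] by blast
  moreover have "length vs \<le> length es + 1"
    using injective_mat_dim_le[of "Z\<^sup>T" "length es + 1" "length vs"] Z_carrier
      kernel_Z_transpose[OF conn ne] by simp
  ultimately show eq: "length vs = length es + 1" by simp
  have "Z \<in> carrier_mat (length es + 1) (length es + 1)" using Z_carrier eq by simp
  from det_0_iff_vec_prod_zero[OF this] show "det Z \<noteq> 0"
    using kernel_Z[OF acyclic ne] unfolding eq by blast
qed

end

section \<open>The optimal gain in block form\<close>

text \<open>
  The right-hand side is \<open>L [I R]\<close> with \<open>L = r D\<^sup>-\<^sup>1 W\<close> and \<open>W = -S\<^sup>T + \<beta> C\<^sup>T H\<close>. It arises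
  because \<open>P = diag(I, 0) + \<beta> [I R]\<^sup>T H [I R]\<close>, where \<open>[I R] B = C\<close> and \<open>[I R] A = r [I R]\<close>.
\<close>

lemma optimal_gain_eq:
  assumes S: "S \<in> carrier_mat n m" and R: "R \<in> carrier_mat n m" and H: "H \<in> carrier_mat n n"
    and inv: "invertible_mat (D_mat \<beta> S R H)"
    and L: "L = sqrt \<beta> \<cdot>\<^sub>m (minv (D_mat \<beta> S R H) * (- S\<^sup>T + \<beta> \<cdot>\<^sub>m ((R - S)\<^sup>T * H)))"
  shows "optimal_gain \<beta> S R H = L @\<^sub>c (L * R)"
proof -
  define C where "C = R - S"
  define W where "W = - S\<^sup>T + \<beta> \<cdot>\<^sub>m (C\<^sup>T * H)"
  define D where "D = D_mat \<beta> S R H"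
  define P where "P = P_mat \<beta> R H"
  define B where "B = B_mat S"
  have C: "C \<in> carrier_mat n m" unfolding C_def using S by (rule minus_carrier_mat)
  have W: "W \<in> carrier_mat m n" unfolding W_def using C H
    by (intro add_carrier_mat smult_carrier_mat mult_carrier_mat[of _ m n]) simp_all
  have D: "D \<in> carrier_mat m m"
    using S by (intro carrier_matI) (simp_all add: D_def D_mat_def Let_def)
  have P: "P \<in> carrier_mat (n + m) (n + m)" using R H by (auto simp: P_def P_mat_def)
  have B: "B \<in> carrier_mat (n + m) m" using S by (auto simp: B_def B_mat_def)
  have BT: "B\<^sup>T = (- S\<^sup>T) @\<^sub>c 1\<^sub>m m"
    unfolding B_def B_mat_def append_rows_def append_columns_def using S
    by (subst transpose_four_block_mat[of _ n m _ 0 _ m]) (auto simp: transpose_uminus)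
  have CTH: "C\<^sup>T * H = R\<^sup>T * H - S\<^sup>T * H"
    unfolding C_def transpose_minus[OF R S] using S R H
    by (intro minus_mult_distrib_mat) simp_all
  have CTHR: "C\<^sup>T * H * R = R\<^sup>T * H * R - S\<^sup>T * H * R"
    unfolding CTH using S R H by (subst minus_mult_distrib_mat[of _ m n]) auto
  have BTP_left: "(- S\<^sup>T) * (1\<^sub>m n + \<beta> \<cdot>\<^sub>m H) + 1\<^sub>m m * (\<beta> \<cdot>\<^sub>m (R\<^sup>T * H)) = W"
  proof -
    have "(- S\<^sup>T) * (1\<^sub>m n + \<beta> \<cdot>\<^sub>m H) = - (S\<^sup>T * (1\<^sub>m n + \<beta> \<cdot>\<^sub>m H))" using S H by simp
    also have "S\<^sup>T * (1\<^sub>m n + \<beta> \<cdot>\<^sub>m H) = S\<^sup>T + \<beta> \<cdot>\<^sub>m (S\<^sup>T * H)"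
      using S H by (subst mult_add_distrib_mat[of _ m n]) (auto simp: mult_smult_distrib[of _ m n])
    finally show ?thesis unfolding W_def CTH using S R H
      by (intro eq_matI) (auto simp: algebra_simps)
  qed
  have BTP_right: "(- S\<^sup>T) * (\<beta> \<cdot>\<^sub>m (H * R)) + 1\<^sub>m m * (\<beta> \<cdot>\<^sub>m (R\<^sup>T * H * R)) = \<beta> \<cdot>\<^sub>m (C\<^sup>T * H * R)"
  proof -
    have "(- S\<^sup>T) * (\<beta> \<cdot>\<^sub>m (H * R)) = - (\<beta> \<cdot>\<^sub>m (S\<^sup>T * H * R))"
      using S R H
      by (intro eq_matI) (auto simp: mult_smult_distrib[of _ m n _ m]
          assoc_mult_mat[of _ m n _ n _ m])
    moreover have "\<beta> \<cdot>\<^sub>m (R\<^sup>T * H * R) \<in> carrier_mat m m" using R H by simp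
    ultimately show ?thesis unfolding CTHR using S R H
      by (intro eq_matI) (auto simp: algebra_simps)
  qed
  have BTP: "B\<^sup>T * P = W @\<^sub>c (\<beta> \<cdot>\<^sub>m (C\<^sup>T * H * R))"
    unfolding BT P_def P_mat_def BTP_left[symmetric] BTP_right[symmetric] using S R H
    by (subst append_columns_mult_four_block[of _ m n _ m _ n _ m]) auto
  have V: "\<beta> \<cdot>\<^sub>m (C\<^sup>T * H * R) \<in> carrier_mat m m" using C H R by simp
  have BTPB: "B\<^sup>T * P * B = D"
  proof -
    have "B\<^sup>T * P * B = W * (- S) + \<beta> \<cdot>\<^sub>m (C\<^sup>T * H * R) * 1\<^sub>m m"
      unfolding BTP unfolding B_def B_mat_def using W V S
      by (subst append_columns_mult_rows[of _ m n _ m _ m]) auto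
    also have "\<beta> \<cdot>\<^sub>m (C\<^sup>T * H * R) * 1\<^sub>m m = \<beta> \<cdot>\<^sub>m (C\<^sup>T * H * R)"
      by (rule right_mult_one_mat[OF V])
    also have "W * (- S) = - (W * S)" using W S by simp
    also have "W * S = - (S\<^sup>T * S) + \<beta> \<cdot>\<^sub>m (C\<^sup>T * H * S)"
      unfolding W_def using S C H
      by (subst add_mult_distrib_mat[of _ m n]) (auto simp: mult_smult_assoc_mat[of _ m n])
    finally have "B\<^sup>T * P * B = - (- (S\<^sup>T * S) + \<beta> \<cdot>\<^sub>m (C\<^sup>T * H * S)) + \<beta> \<cdot>\<^sub>m (C\<^sup>T * H * R)" .
    moreover have "C\<^sup>T * H * C = C\<^sup>T * H * R - C\<^sup>T * H * S"
      unfolding C_def[THEN arg_cong[where f = "\<lambda>X. C\<^sup>T * H * X"]] using S R C H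
      by (subst mult_minus_distrib_mat[of _ m n _ m]) auto
    ultimately show ?thesis
      unfolding D_def D_mat_def Let_def C_def[symmetric] using S R C H
      by (intro eq_matI) (auto simp: algebra_simps)
  qed
  have A: "A_mat \<beta> R = sqrt \<beta> \<cdot>\<^sub>m four_block_mat (1\<^sub>m n) R (0\<^sub>m m n) (0\<^sub>m m m)"
    using R by (simp add: A_mat_def)
  have BTPA: "B\<^sup>T * P * A_mat \<beta> R = sqrt \<beta> \<cdot>\<^sub>m (W @\<^sub>c (W * R))"
  proof -
    have "B\<^sup>T * P * A_mat \<beta> R
      = sqrt \<beta> \<cdot>\<^sub>m (B\<^sup>T * P * four_block_mat (1\<^sub>m n) R (0\<^sub>m m n) (0\<^sub>m m m))"
      unfolding A using B P R by (intro mult_smult_distrib[of _ m "n + m" _ "n + m"]) auto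
    also have "B\<^sup>T * P * four_block_mat (1\<^sub>m n) R (0\<^sub>m m n) (0\<^sub>m m m) = W @\<^sub>c (W * R)"
      unfolding BTP
        append_columns_mult_four_block[OF W V one_carrier_mat R zero_carrier_mat zero_carrier_mat]
      using W R right_mult_zero_mat[OF V] by simp
    finally show ?thesis .
  qed
  have Di: "minv D \<in> carrier_mat m m" using minv_inverse(3)[OF D] inv by (simp add: D_def)
  have Ac: "A_mat \<beta> R \<in> carrier_mat (n + m) (n + m)" unfolding A using R by auto
  have "optimal_gain \<beta> S R H = minv D * B\<^sup>T * P * A_mat \<beta> R"
    by (simp add: optimal_gain_def Let_def BTPB flip: P_def B_def)
  also have "\<dots> = minv D * (B\<^sup>T * P * A_mat \<beta> R)"
    using Di B P Ac
    by (simp add: assoc_mult_mat[of _ m "n + m" _ "n + m" _ "n + m"]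
        assoc_mult_mat[of _ m m _ "n + m" _ "n + m"])
  also have "\<dots> = sqrt \<beta> \<cdot>\<^sub>m (minv D * (W @\<^sub>c (W * R)))"
    unfolding BTPA
    by (rule mult_smult_distrib[OF Di append_columns_carrier[OF W mult_carrier_mat[OF W R]]])
  also have "minv D * (W @\<^sub>c (W * R)) = (minv D * W) @\<^sub>c (minv D * W * R)"
    using Di W R by (subst mult_append_columns[of _ m m _ n _ m]) auto
  also have "sqrt \<beta> \<cdot>\<^sub>m \<dots> = L @\<^sub>c (L * R)"
    unfolding L D_def[symmetric] C_def[symmetric] W_def[symmetric] using Di W R
    by (subst smult_append_columns[of _ m n _ m]) (auto simp: mult_smult_assoc_mat[of _ m n])
  finally show ?thesis .
qed

theorem proposition1:
  fixes G :: "('v, 'e) pre_digraph" and vs :: "'v list" and es :: "'e list"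
    and N m :: nat and \<beta> r :: real and S R C H D Z F Y U :: "real mat"
  assumes "directed_tree G"
    and "distinct vs" and "set vs = verts G" and "N = length vs"
    and "distinct es" and "set es = arcs G" and "m = length es"
    and "0 < \<beta>" and "\<beta> < 1" and "r = sqrt \<beta>"
    and "S = sender_mat G vs es" and "R = receiver_mat G vs es" and "C = R - S"
    and "psd_mat N H" and "reduced_DARE \<beta> S R H" and "stabilizing \<beta> S R H"
    and "D = D_mat \<beta> S R H"
    and "Z = C @\<^sub>c ones_col N"
    and "F = (- r) \<cdot>\<^sub>m (minv D * (- S\<^sup>T + \<beta> \<cdot>\<^sub>m (C\<^sup>T * H)))"
    and "Y = four_block_mat Z (- R) (0\<^sub>m m N) (1\<^sub>m m)"
    and "U = (F * Z) @\<^sub>c 0\<^sub>m m m"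
  shows "RI_implementation (optimal_gain \<beta> S R H) Y U"
proof -
  interpret I: incidence G vs es
    using assms(1-7) by (auto simp: incidence_def directed_tree_def)
  have IZ: "I.Z = Z" by (simp add: I.Z_def I.C_def assms)
  have N: "N = m + 1" using I.directed_tree_Z(1)[OF assms(1)] assms by simp
  have Z: "Z \<in> carrier_mat N N" using I.Z_carrier IZ N assms(4,7) by simp
  have detZ: "det Z \<noteq> 0" using I.directed_tree_Z(2)[OF assms(1)] IZ by simp
  have S: "S \<in> carrier_mat N m" and R: "R \<in> carrier_mat N m"
    unfolding assms by (simp_all add: sender_mat_def receiver_mat_def)
  have H: "H \<in> carrier_mat N N" using assms(14) by (simp add: psd_mat_def)
  have Dinv: "invertible_mat D" using assms(15,17) by (simp add: reduced_DARE_def Let_def)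
  have Dc: "D \<in> carrier_mat m m"
    using S by (intro carrier_matI) (simp_all add: assms(17) D_mat_def Let_def)
  define W where "W = - S\<^sup>T + \<beta> \<cdot>\<^sub>m (C\<^sup>T * H)"
  have W: "W \<in> carrier_mat m N"
    using S H by (intro carrier_matI) (simp_all add: W_def assms(13))
  define L where "L = r \<cdot>\<^sub>m (minv D * W)"
  have L: "L \<in> carrier_mat m N" using minv_inverse(3)[OF Dc Dinv] W by (simp add: L_def)
  have F: "F = - L" by (auto simp: assms(19) L_def W_def[symmetric])
  define K where "K = optimal_gain \<beta> S R H"
  have K: "K = L @\<^sub>c (L * R)"
    unfolding K_def L_def W_def assms(10,13,17)
    by (rule optimal_gain_eq[OF S R H]) (use Dinv assms(17) in simp_all)
  have Kc: "K \<in> carrier_mat m (N + m)" unfolding K using L R by (intro append_columns_carrier) auto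
  have Yc: "Y \<in> carrier_mat (N + m) (N + m)" unfolding assms(20) using Z by auto
  have Uc: "U \<in> carrier_mat m (N + m)"
    unfolding assms(21) F using L Z by (intro append_columns_carrier) auto
  have "det Y = det Z" unfolding assms(20) using Z R
    by (subst det_four_block_mat_lower_left_zero[of _ N _ m]) auto
  then have Yinv: "invertible_mat Y" using det_nonzero_imp_invertible_mat[OF Yc] detZ by simp
  have "K * Y = (L * Z) @\<^sub>c 0\<^sub>m m m"
  proof -
    have "K * Y = (L * Z + L * R * 0\<^sub>m m N) @\<^sub>c (L * (- R) + L * R * 1\<^sub>m m)"
      unfolding K assms(20) using L R Z
      by (intro append_columns_mult_four_block[of _ m N _ m _ N _ m]) auto
    also have "L * (- R) + L * R * 1\<^sub>m m = 0\<^sub>m m m"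
      using L R by (intro eq_matI) auto
    finally show ?thesis using L R Z by simp
  qed
  also have "\<dots> = - U"
    unfolding assms(21) F using L Z by (intro eq_matI) (auto simp: append_columns_def)
  finally have KY: "K * Y = - U" .
  have "K = K * (Y * minv Y)" using Kc minv_inverse(1)[OF Yc Yinv] by simp
  also have "\<dots> = K * Y * minv Y" using Kc Yc minv_inverse(3)[OF Yc Yinv] by (simp add: assoc_mult_mat)
  also have "\<dots> = - (U * minv Y)" unfolding KY using Uc minv_inverse(3)[OF Yc Yinv] by simp
  finally have "K = - (U * minv Y)" .
  then show ?thesis
    unfolding RI_implementation_def K_def[symmetric] carrier_matD[OF Kc]
    using Yc Uc Yinv by blast
qed

end
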